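(* For any positive integer $m$, \[ \sum_{k=0}^n\binom{mn}{mk}\sim \frac{1}{m}\exp(mn\log 2)=\frac{2^{mn}}{m} \] as $n\to\infty$.
   Context: For $f,g:\mathbb{Z}_{\ge 0}\to\mathbb{C}$, $f\sim g$ means $\lim_{n\to\infty} f(n)/g(n)=1$. Here $m$ is fixed and both sides are regarded as functions of $n\in\mathbb{Z}_{\ge 0}$; $\log$ is the natural logarithm. *)

theory Defs
  imports Complex_Main "HOL-Library.Landau_Symbols"
begin

end

theory Submission
  imports Defs
begin

text \<open>
  Write \<open>\<omega> = cis (2 * pi / m)\<close>. Averaging the binomial expansions of \<open>(1 + \<omega> ^ j) ^ N\<close> over
  \<open>j < m\<close> keeps exactly the coefficients whose index is a multiple of \<open>m\<close>
  (lemma \<open>sum_choose_multiples\<close>). For \<open>N = m * n\<close> this makes \<open>m\<close> times the sum in question,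
  divided by \<open>2 ^ (m * n)\<close>, equal to the sum over \<open>j < m\<close> of the powers
  \<open>((1 + \<omega> ^ j) / 2) ^ (m * n)\<close>. The term \<open>j = 0\<close> is \<open>1\<close>; every other one tends to \<open>0\<close>, because
  \<open>1 + z\<close> has modulus less than \<open>2\<close> when \<open>z \<noteq> 1\<close> lies on the unit circle
  (lemma \<open>norm_one_plus_less_2\<close>).
\<close>

lemma cis_power_eq_1_iff:
  fixes m l :: nat
  assumes "m > 0"
  shows "cis (2 * pi / real m) ^ l = 1 \<longleftrightarrow> m dvd l"
proof
  assume "cis (2 * pi / real m) ^ l = 1"
  then have "cos (real l * (2 * pi / real m)) = 1"
    by (simp add: DeMoivre complex_eq_iff)
  then obtain k :: int where "real l * (2 * pi / real m) = of_int k * 2 * pi"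
    by (auto simp: cos_one_2pi_int)
  then have "real l = of_int k * real m"
    using assms by (simp add: field_simps)
  then have "int l = k * int m"
    by (metis of_int_eq_iff of_int_mult of_int_of_nat_eq)
  then show "m dvd l"
    by (metis dvd_triv_right int_dvd_int_iff)
next
  assume "m dvd l"
  then obtain k where l: "l = m * k" ..
  have "cis (2 * pi / real m) ^ m = 1"
    using assms by (simp add: DeMoivre)
  then show "cis (2 * pi / real m) ^ l = 1"
    by (simp add: l power_mult)
qed

lemma sum_roots_unity_power:
  fixes m l :: nat
  assumes "m > 0"
  shows "(\<Sum>j<m. (cis (2 * pi / real m) ^ j) ^ l) = (if m dvd l then of_nat m else 0)"
proof -
  define z where "z = cis (2 * pi / real m) ^ l"
  have sum_eq: "(\<Sum>j<m. (cis (2 * pi / real m) ^ j) ^ l) = (\<Sum>j<m. z ^ j)"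
    by (simp add: z_def mult.commute flip: power_mult)
  have "z ^ m = (cis (2 * pi / real m) ^ m) ^ l"
    by (simp add: z_def mult.commute flip: power_mult)
  also have "\<dots> = 1"
    using cis_power_eq_1_iff[OF assms, of m] by simp
  finally have "z ^ m = 1" .
  moreover have "z = 1 \<longleftrightarrow> m dvd l"
    unfolding z_def by (rule cis_power_eq_1_iff[OF assms])
  ultimately show ?thesis
    unfolding sum_eq by (auto simp: geometric_sum)
qed

lemma sum_choose_multiples:
  fixes m n :: nat
  assumes "m > 0"
  shows "(\<Sum>j<m. (1 + cis (2 * pi / real m) ^ j) ^ (m * n)) =
           of_nat m * (\<Sum>k=0..n. of_nat ((m * n) choose (m * k)))"
proof -
  let ?w = "cis (2 * pi / real m)"
  have "(\<Sum>j<m. (1 + ?w ^ j) ^ (m * n)) =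
          (\<Sum>j<m. \<Sum>l\<le>m * n. of_nat ((m * n) choose l) * (?w ^ j) ^ l)"
    by (simp add: binomial_ring[of "?w ^ _" 1] add.commute[of 1])
  also have "\<dots> = (\<Sum>l\<le>m * n. \<Sum>j<m. of_nat ((m * n) choose l) * (?w ^ j) ^ l)"
    by (rule sum.swap)
  also have "\<dots> = (\<Sum>l\<le>m * n. of_nat ((m * n) choose l) * (if m dvd l then of_nat m else 0))"
    by (simp only: sum_distrib_left[symmetric] sum_roots_unity_power[OF assms])
  also have "\<dots> = (\<Sum>l \<in> (\<lambda>k. m * k) ` {0..n}. of_nat ((m * n) choose l) * of_nat m)"
    using assms by (intro sum.mono_neutral_cong_right) auto
  also have "\<dots> = (\<Sum>k=0..n. of_nat ((m * n) choose (m * k)) * of_nat m)"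
    using assms by (subst sum.reindex) (auto simp: inj_on_def)
  also have "\<dots> = of_nat m * (\<Sum>k=0..n. of_nat ((m * n) choose (m * k)))"
    by (simp add: sum_distrib_left mult.commute)
  finally show ?thesis .
qed

lemma norm_one_plus_less_2:
  fixes z :: complex
  assumes "norm z = 1" "z \<noteq> 1"
  shows "norm (1 + z) < 2"
proof -
  have circle: "(Re z)\<^sup>2 + (Im z)\<^sup>2 = 1"
    using assms(1) by (simp add: cmod_def)
  have "Re z \<le> 1"
    using complex_Re_le_cmod[of z] assms(1) by simp
  moreover have "Re z \<noteq> 1"
    using circle assms(2) by (auto simp: complex_eq_iff)
  ultimately have "Re z < 1"
    by simp
  then have "(norm (1 + z))\<^sup>2 < 2\<^sup>2"
    using circle by (simp add: cmod_power2 power2_sum)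
  then show ?thesis
    by (rule power_less_imp_less_base) simp
qed

lemma sum_roots_unity_powers_tendsto_1:
  fixes m :: nat
  assumes "m > 0"
  shows "(\<lambda>n. \<Sum>j<m. ((1 + cis (2 * pi / real m) ^ j) / 2) ^ (m * n)) \<longlonglongrightarrow> 1"
proof -
  let ?w = "cis (2 * pi / real m)"
  have "(\<lambda>n. ((1 + ?w ^ j) / 2) ^ (m * n)) \<longlonglongrightarrow> (if j = 0 then 1 else 0)" if "j < m" for j
  proof (cases "j = 0")
    case False
    have "?w ^ j \<noteq> 1"
      using cis_power_eq_1_iff[OF assms, of j] that False by (auto dest: dvd_imp_le)
    then have "norm (1 + ?w ^ j) < 2"
      by (intro norm_one_plus_less_2) (simp_all add: norm_power)
    then have "norm (((1 + ?w ^ j) / 2) ^ m) < 1"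
      using assms by (simp add: norm_power norm_divide power_less_one_iff)
    then show ?thesis
      using False by (simp add: power_mult LIMSEQ_power_zero)
  qed simp
  then have "(\<lambda>n. \<Sum>j<m. ((1 + ?w ^ j) / 2) ^ (m * n)) \<longlonglongrightarrow> (\<Sum>j<m. if j = 0 then 1 else 0)"
    by (intro tendsto_sum) auto
  then show ?thesis
    using assms by simp
qed

theorem theorem8p1:
  fixes m :: nat
  assumes "m > 0"
  shows "(\<lambda>n::nat. \<Sum>k=0..n. (of_nat ((m * n) choose (m * k)) :: complex))
           \<sim>[at_top]
         (\<lambda>n::nat. 1 / of_nat m * exp (of_nat (m * n) * complex_of_real (ln 2)))
       \<and> (\<forall>n::nat. 1 / of_nat m * exp (of_nat (m * n) * complex_of_real (ln 2))
                  = 2 ^ (m * n) / (of_nat m :: complex))"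
proof -
  have exp_eq: "1 / of_nat m * exp (of_nat (m * n) * complex_of_real (ln 2))
                  = 2 ^ (m * n) / (of_nat m :: complex)" for n
    by (simp only: exp_of_nat_mult exp_of_real) simp
  have ratio: "(\<Sum>k=0..n. (of_nat ((m * n) choose (m * k)) :: complex)) / (2 ^ (m * n) / of_nat m)
             = (\<Sum>j<m. ((1 + cis (2 * pi / real m) ^ j) / 2) ^ (m * n))" for n
    using sum_choose_multiples[OF assms, of n]
    by (simp add: power_divide mult.commute flip: sum_divide_distrib)
  have "(\<lambda>n. \<Sum>k=0..n. (of_nat ((m * n) choose (m * k)) :: complex))
          \<sim>[at_top] (\<lambda>n. 2 ^ (m * n) / of_nat m)"
    by (rule asymp_equivI') (simp only: ratio sum_roots_unity_powers_tendsto_1[OF assms])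
  then show ?thesis
    unfolding exp_eq by simp
qed

end
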